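(* For every number of agents $n\ge 2$, $$\mathrm{Reg}=\max_{x\in C}\left[\mathrm{cav}[P^*](x)-P^*(x)\right].$$
   Context: Setting: fix a number of agents $n$, a prior $\mu\in(0,1)$ and posteriors $0\le p_1<\frac12<p_2\le 1$ with $p_1<\mu<p_2$. An information structure is a probability distribution $\pi$ on $\{0,1\}\times\{L,H\}^n$, the law of $(\omega,s_1,\dots,s_n)$, such that $\pi(\omega=1)=\mu$ and, for every $i$, both values of $s_i$ have positive probability and $\pi(\omega=1\mid s_i=L)=p_1$, $\pi(\omega=1\mid s_i=H)=p_2$. Define $$a=\frac{(1-p_2)(\mu-p_1)}{(1-\mu)(p_2-p_1)},\qquad b=\frac{p_2(\mu-p_1)}{\mu(p_2-p_1)}.$$ Let $\nu\in\{0,\frac1n,\dots,1\}$ be the fraction of agents $i$ with $s_i=H$; $\hat\pi$ is the law of $(\omega,\nu)$ induced by $\pi$, and $\hat\pi_0,\hat\pi_1$ are the conditional laws of $\nu$ given $\omega=0$ and $\omega=1$. An aggregation rule is a function $f:\{0,\frac1n,\dots,1\}\to[0,1]$. Put $P(f,\pi)=\mu\,\mathbb{E}_{\nu\sim\hat\pi_1}[f(\nu)]+(1-\mu)\,\mathbb{E}_{\nu\sim\hat\pi_0}[1-f(\nu)]$ and $P^*(\pi)=\mathbb{E}_{\nu\sim\hat\pi}[\max\{\hat\pi(\omega=0\mid\nu),\hat\pi(\omega=1\mid\nu)\}]$. Put $\mathrm{Reg}(f,\pi)=P^*(\pi)-P(f,\pi)$, $\mathrm{Reg}(f)=\max_\pi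 \mathrm{Reg}(f,\pi)$ over all information structures $\pi$, and $\mathrm{Reg}=\min_f\mathrm{Reg}(f)$ over all aggregation rules. Write $[n]=\{1,\dots,n\}$. Information structures are identified with points of the polytope $$C=\Big\{x=(x^\omega_D)_{D\subseteq[n],\,\omega\in\{0,1\}}\in\mathbb{R}^{2^{n+1}}:\ x^\omega_D\ge 0,\ \sum_{D\subseteq[n]}x^0_D=1-\mu,\ \sum_{D\subseteq[n]}x^1_D=\mu,\ \forall i\in[n]:\ \sum_{D\ni i}x^0_D=(1-\mu)a,\ \sum_{D\ni i}x^1_D=\mu b\Big\},$$ where $x^\omega_D$ is the probability that the state is $\omega$ and the set of agents with signal $H$ is exactly $D$. Under this identification $P^*$ is the function $P^*:C\to[0,1]$, $$P^*(x)=\sum_{i=0}^n\max\Big\{\sum_{|D|=i}x^0_D,\ \sum_{|D|=i}x^1_D\Big\}.$$ For a function $h:C\to\mathbb{R}$, its concavification $\mathrm{cav}[h]:C\to\mathbb{R}$ is the pointwise minimum of all concave functions $\tilde h:C\to\mathbb{R}$ with $\tilde h\ge h$ on $C$. *)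

theory Defs
  imports "HOL-Probability.Probability"
begin

text \<open>
  The agents are the elements of a finite type \<open>'n\<close>, so that \<open>n = CARD('n)\<close> and \<open>[n] = UNIV\<close>.
  States are Booleans: \<open>True\<close> is the state 1 and \<open>False\<close> is the state 0.
\<close>

datatype signal = L | H

definition info_structures ::
    "real \<Rightarrow> real \<Rightarrow> real \<Rightarrow> (bool \<times> ('n::finite \<Rightarrow> signal)) pmf set" where
  "info_structures \<mu> p1 p2 =
    {\<pi>. \<P>(z in measure_pmf \<pi>. fst z = True) = \<mu> \<and>
        (\<forall>i. \<P>(z in measure_pmf \<pi>. snd z i = L) > 0 \<and>
             \<P>(z in measure_pmf \<pi>. snd z i = H) > 0 \<and>
             \<P>(z in measure_pmf \<pi>. fst z = True \<bar> snd z i = L) = p1 \<and>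
             \<P>(z in measure_pmf \<pi>. fst z = True \<bar> snd z i = H) = p2)}"

definition frac_high :: "('n::finite \<Rightarrow> signal) \<Rightarrow> real" where
  "frac_high s = real (card {i. s i = H}) / real CARD('n)"

definition hat :: "(bool \<times> ('n::finite \<Rightarrow> signal)) pmf \<Rightarrow> (bool \<times> real) pmf" where
  "hat \<pi> = map_pmf (\<lambda>(\<omega>, s). (\<omega>, frac_high s)) \<pi>"

definition hat_given :: "bool \<Rightarrow> (bool \<times> ('n::finite \<Rightarrow> signal)) pmf \<Rightarrow> real pmf" where
  "hat_given w \<pi> = map_pmf snd (cond_pmf (hat \<pi>) {(\<omega>, \<nu>). \<omega> = w})"

definition agg_rules :: "nat \<Rightarrow> (real \<Rightarrow> real) set" where
  "agg_rules n = {real k / real n |k. k \<le> n} \<rightarrow>\<^sub>E {0..1}"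

definition performance ::
    "real \<Rightarrow> (real \<Rightarrow> real) \<Rightarrow> (bool \<times> ('n::finite \<Rightarrow> signal)) pmf \<Rightarrow> real" where
  "performance \<mu> f \<pi> =
     \<mu> * measure_pmf.expectation (hat_given True \<pi>) (\<lambda>\<nu>. f \<nu>) +
     (1 - \<mu>) * measure_pmf.expectation (hat_given False \<pi>) (\<lambda>\<nu>. 1 - f \<nu>)"

definition opt_performance :: "(bool \<times> ('n::finite \<Rightarrow> signal)) pmf \<Rightarrow> real" where
  "opt_performance \<pi> =
     measure_pmf.expectation (map_pmf snd (hat \<pi>))
       (\<lambda>\<nu>. max \<P>(z in measure_pmf (hat \<pi>). fst z = False \<bar> snd z = \<nu>)
                \<P>(z in measure_pmf (hat \<pi>). fst z = True \<bar> snd z = \<nu>))"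

definition regret ::
    "real \<Rightarrow> (real \<Rightarrow> real) \<Rightarrow> (bool \<times> ('n::finite \<Rightarrow> signal)) pmf \<Rightarrow> real" where
  "regret \<mu> f \<pi> = opt_performance \<pi> - performance \<mu> f \<pi>"

text \<open>
  The maximum over information structures and the minimum over aggregation rules are rendered
  by \<open>SUP\<close> and \<open>INF\<close>; attainment has to be asserted separately where it matters.
  The type argument fixes the set of agents.
\<close>

definition worst_regret ::
    "'n::finite itself \<Rightarrow> real \<Rightarrow> real \<Rightarrow> real \<Rightarrow> (real \<Rightarrow> real) \<Rightarrow> real" where
  "worst_regret _ \<mu> p1 p2 f =
     (SUP \<pi> \<in> (info_structures \<mu> p1 p2 :: (bool \<times> ('n \<Rightarrow> signal)) pmf set). regret \<mu> f \<pi>)"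

definition Reg :: "'n::finite itself \<Rightarrow> real \<Rightarrow> real \<Rightarrow> real \<Rightarrow> real" where
  "Reg T \<mu> p1 p2 = (INF f \<in> agg_rules CARD('n). worst_regret T \<mu> p1 p2 f)"

definition a_par :: "real \<Rightarrow> real \<Rightarrow> real \<Rightarrow> real" where
  "a_par \<mu> p1 p2 = (1 - p2) * (\<mu> - p1) / ((1 - \<mu>) * (p2 - p1))"

definition b_par :: "real \<Rightarrow> real \<Rightarrow> real \<Rightarrow> real" where
  "b_par \<mu> p1 p2 = p2 * (\<mu> - p1) / (\<mu> * (p2 - p1))"

text \<open>
  \<open>x $ (\<omega>, D)\<close> is the probability that the state is \<open>\<omega>\<close> and that \<open>D\<close> is exactly the set of
  agents with signal \<open>H\<close>.
\<close>

definition polyC :: "real \<Rightarrow> real \<Rightarrow> real \<Rightarrow> (real ^ (bool \<times> 'n::finite set)) set" where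
  "polyC \<mu> p1 p2 =
    {x. (\<forall>\<omega> D. x $ (\<omega>, D) \<ge> 0) \<and>
        (\<Sum>D\<in>UNIV. x $ (False, D)) = 1 - \<mu> \<and>
        (\<Sum>D\<in>UNIV. x $ (True, D)) = \<mu> \<and>
        (\<forall>i. (\<Sum>D | i \<in> D. x $ (False, D)) = (1 - \<mu>) * a_par \<mu> p1 p2 \<and>
             (\<Sum>D | i \<in> D. x $ (True, D)) = \<mu> * b_par \<mu> p1 p2)}"

definition Pstar :: "real ^ (bool \<times> 'n::finite set) \<Rightarrow> real" where
  "Pstar x = (\<Sum>i=0..CARD('n). max (\<Sum>D | card D = i. x $ (False, D))
                                   (\<Sum>D | card D = i. x $ (True, D)))"

definition concave_majorants :: "'a::real_vector set \<Rightarrow> ('a \<Rightarrow> real) \<Rightarrow> ('a \<Rightarrow> real) set" where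
  "concave_majorants C h = {g. concave_on C g \<and> (\<forall>y\<in>C. h y \<le> g y)}"

definition cav :: "'a::real_vector set \<Rightarrow> ('a \<Rightarrow> real) \<Rightarrow> 'a \<Rightarrow> real" where
  "cav C h x = (INF g \<in> concave_majorants C h. g x)"

text \<open>
  As soon as a concave majorant exists, the infimum in the definition of \<open>cav\<close> is a minimum,
  since \<open>cav C h\<close> is itself a concave majorant.
\<close>

lemma cav_le:
  assumes "g \<in> concave_majorants C h" "x \<in> C"
  shows "cav C h x \<le> g x"
  unfolding cav_def
  by (rule cINF_lower[OF _ assms(1)])
     (use assms(2) in \<open>auto simp: concave_majorants_def intro!: bdd_belowI2[where m="h x"]\<close>)

lemma cav_mem_concave_majorants:
  assumes "concave_majorants C h \<noteq> {}"
  shows "cav C h \<in> concave_majorants C h"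
proof -
  have "convex C"
    using assms by (auto simp: concave_majorants_def concave_on_def convex_on_def)
  moreover have "h x \<le> cav C h x" if "x \<in> C" for x
    unfolding cav_def
    by (rule cINF_greatest[OF assms]) (use that in \<open>auto simp: concave_majorants_def\<close>)
  moreover have "u * cav C h x + v * cav C h y \<le> cav C h (u *\<^sub>R x + v *\<^sub>R y)"
    if *: "x \<in> C" "y \<in> C" "0 \<le> u" "0 \<le> v" "u + v = 1" for x y u v
    unfolding cav_def[of C h "u *\<^sub>R x + v *\<^sub>R y"]
  proof (rule cINF_greatest[OF assms])
    fix g assume g: "g \<in> concave_majorants C h"
    have "u * cav C h x + v * cav C h y \<le> u * g x + v * g y"
      using cav_le[OF g] * by (intro add_mono mult_left_mono) auto
    also have "\<dots> \<le> g (u *\<^sub>R x + v *\<^sub>R y)"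
      using g * by (auto simp: concave_majorants_def concave_on_iff)
    finally show "u * cav C h x + v * cav C h y \<le> g (u *\<^sub>R x + v *\<^sub>R y)" .
  qed
  ultimately show ?thesis
    by (auto simp: concave_majorants_def concave_on_iff)
qed

end

theory Submission
  imports Defs
begin

text \<open>
  In the coordinates of \<open>polyC\<close>, the performance of a rule \<open>f\<close> is a linear function \<open>l\<^sub>f\<close>, and \<open>Pstar\<close>
  is the maximum of these functions. Since \<open>l\<^sub>f\<close> plus the worst-case regret of \<open>f\<close> is a concave
  majorant of \<open>Pstar\<close>, the worst-case regret is at least \<open>V = SUP (cav Pstar - Pstar)\<close>. Conversely,
  \<open>Pstar\<close> is sublinear on the whole space, so separating the hypograph of \<open>cav Pstar\<close> from the
  epigraph of \<open>Pstar + V\<close> gives a linear \<open>m \<le> Pstar\<close> with \<open>cav Pstar \<le> m + V\<close> on \<open>polyC\<close>. Every linear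
  minorant of \<open>Pstar\<close> is some \<open>l\<^sub>f\<close>, and this \<open>f\<close> has worst-case regret at most \<open>V\<close>.
\<close>

subsection \<open>Concavification\<close>

text \<open>A continuous function on a compact set is bounded above. This keeps
  \<open>concave_majorants C h\<close> nonempty, so that \<open>cav C h\<close> is itself a concave
  majorant.\<close>

lemma const_concave_majorant:
  fixes C :: "'a::real_normed_vector set"
  assumes C: "compact C" "convex C" and h: "continuous_on C h"
  obtains B where "(\<lambda>_. B) \<in> concave_majorants C h"
proof -
  obtain B where "\<And>x. x \<in> C \<Longrightarrow> h x \<le> B"
    using compact_continuous_image[OF h C(1)]
    by (metis bounded_imp_bdd_above compact_imp_bounded bdd_above.E imageI)
  with C that show thesis
    by (auto simp: concave_majorants_def concave_on_iff simp flip: distrib_right)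
qed

lemma convex_hypograph_concave_on:
  assumes g: "concave_on C g"
  shows "convex {z. fst z \<in> C \<and> snd z \<le> g (fst z)}"
  unfolding convex_def
proof (clarsimp, intro conjI)
  fix x y s t and u v :: real
  assume *: "x \<in> C" "s \<le> g x" "y \<in> C" "t \<le> g y" "0 \<le> u" "0 \<le> v" "u + v = 1"
  show "u *\<^sub>R x + v *\<^sub>R y \<in> C"
    using g * by (auto simp: concave_on_iff convex_def)
  have "u * s + v * t \<le> u * g x + v * g y"
    using * by (intro add_mono mult_left_mono) auto
  also have "\<dots> \<le> g (u *\<^sub>R x + v *\<^sub>R y)"
    using g * by (auto simp: concave_on_iff)
  finally show "u * s + v * t \<le> g (u *\<^sub>R x + v *\<^sub>R y)" .
qed

text \<open>The hypograph of a concave majorant is convex and contains the graph of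
  \<open>h\<close>, hence also its convex hull.\<close>

lemma convex_hull_graph_le_concave:
  fixes C :: "'a::real_vector set"
  assumes g: "g \<in> concave_majorants C h"
    and z: "z \<in> convex hull ((\<lambda>x. (x, h x)) ` C)"
  shows "fst z \<in> C \<and> snd z \<le> g (fst z)"
proof -
  have "convex {z. fst z \<in> C \<and> snd z \<le> g (fst z)}"
    using g by (intro convex_hypograph_concave_on) (simp add: concave_majorants_def)
  moreover have "(\<lambda>x. (x, h x)) ` C \<subseteq> {z. fst z \<in> C \<and> snd z \<le> g (fst z)}"
    using g by (auto simp: concave_majorants_def)
  ultimately show ?thesis
    using z hull_minimal by blast
qed

text \<open>For continuous \<open>h\<close> on a compact set, the upper boundary of the convex hull of the graph of
  \<open>h\<close> is \<open>cav C h\<close>; being compact, this hull also yields the attainment.\<close>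

lemma cav_le_convex_hull_graph:
  fixes C :: "'a::euclidean_space set"
  assumes C: "compact C" "convex C" and h: "continuous_on C h" and x: "x \<in> C"
  obtains t where "(x, t) \<in> convex hull ((\<lambda>x. (x, h x)) ` C)" "cav C h x \<le> t"
proof -
  define K where "K = convex hull ((\<lambda>x. (x, h x)) ` C)"
  have K: "compact K"
    unfolding K_def using C h
    by (intro compact_convex_hull compact_continuous_image continuous_intros)
  obtain B where const: "(\<lambda>_. B) \<in> concave_majorants C h"
    using const_concave_majorant[OF C h] .
  define g where "g x = Sup {t. (x, t) \<in> K}" for x
  have upper: "t \<le> B" if "(y, t) \<in> K" for y t
    using convex_hull_graph_le_concave[OF const, of "(y, t)"] that by (auto simp: K_def)
  have le_g: "t \<le> g y" if "(y, t) \<in> K" for y t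
    unfolding g_def by (rule cSup_upper) (use that upper in \<open>auto simp: bdd_above_def\<close>)
  have base: "(y, h y) \<in> K" if "y \<in> C" for y
    unfolding K_def using that by (intro hull_inc) auto
  \<comment> \<open>The fibre of \<open>K\<close> over \<open>y\<close> is the projection of a
    closed slice of a compact set, so it contains its supremum.\<close>
  have attained: "(y, g y) \<in> K" if "y \<in> C" for y
  proof -
    have "{t. (y, t) \<in> K} = snd ` (K \<inter> fst -` {y})" by force
    moreover have "compact (K \<inter> fst -` {y})"
      using K by (intro compact_Int_closed closed_vimage continuous_intros) auto
    ultimately have "compact {t. (y, t) \<in> K}"
      by (simp add: compact_continuous_image continuous_on_snd)
    then have "Sup {t. (y, t) \<in> K} \<in> {t. (y, t) \<in> K}"
      using base[OF that] upper
      by (intro closed_contains_Sup compact_imp_closed) (auto simp: bdd_above_def)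
    then show ?thesis by (simp add: g_def)
  qed
  \<comment> \<open>Concavity of \<open>g\<close> is convexity of \<open>K\<close>: a combination of
    two top points lies in \<open>K\<close>, hence below the top of its own fibre.\<close>
  have "g \<in> concave_majorants C h"
    unfolding concave_majorants_def concave_on_iff
  proof (safe intro!: C)
    fix y z and u v :: real
    assume *: "y \<in> C" "z \<in> C" "0 \<le> u" "0 \<le> v" "u + v = 1"
    have "u *\<^sub>R (y, g y) + v *\<^sub>R (z, g z) \<in> K"
      using attained * convex_convex_hull unfolding K_def by (intro convexD) auto
    then show "u * g y + v * g z \<le> g (u *\<^sub>R y + v *\<^sub>R z)"
      by (intro le_g) auto
  qed (use base le_g in auto)
  from cav_le[OF this x] attained[OF x] show thesis
    using that by (auto simp: K_def)
qed

text \<open>No continuity of \<open>cav C h\<close> is used. Instead the continuous function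
  \<open>snd z - h (fst z)\<close> is maximised over the compact hull \<open>K\<close>: points of
  \<open>K\<close> lie below \<open>cav C h\<close>, and each value of \<open>cav C h\<close> lies
  below some point of \<open>K\<close>.\<close>

lemma cav_gap_attained:
  fixes C :: "'a::euclidean_space set"
  assumes C: "compact C" "convex C" "C \<noteq> {}" and h: "continuous_on C h"
  shows "\<exists>y\<in>C. \<forall>x\<in>C. cav C h x - h x \<le> cav C h y - h y"
proof -
  define K where "K = convex hull ((\<lambda>x. (x, h x)) ` C)"
  have majorant: "cav C h \<in> concave_majorants C h"
    using cav_mem_concave_majorants const_concave_majorant[OF C(1,2) h] by blast
  have K: "z \<in> K \<Longrightarrow> fst z \<in> C \<and> snd z \<le> cav C h (fst z)" for z
    unfolding K_def using convex_hull_graph_le_concave[OF majorant] .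
  have "compact K" "K \<noteq> {}"
    unfolding K_def using C h
    by (auto intro!: compact_convex_hull compact_continuous_image continuous_intros)
  moreover have "continuous_on K (\<lambda>z. snd z - h (fst z))"
    using K by (intro continuous_intros continuous_on_compose2[OF h]) auto
  ultimately obtain z where z: "z \<in> K" "\<And>w. w \<in> K \<Longrightarrow> snd w - h (fst w) \<le> snd z - h (fst z)"
    using continuous_attains_sup by (metis (no_types, lifting))
  show ?thesis
  proof (intro bexI ballI)
    fix x assume "x \<in> C"
    then obtain t where "(x, t) \<in> K" "cav C h x \<le> t"
      using cav_le_convex_hull_graph[OF C(1,2) h] unfolding K_def by blast
    then show "cav C h x - h x \<le> cav C h (fst z) - h (fst z)"
      using z(2)[of "(x, t)"] K[OF z(1)] by auto
  qed (use K z in auto)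
qed

text \<open>A Hahn-Banach sandwich, obtained by separating the hypograph of \<open>g\<close> from the strict
  epigraph of \<open>p + V\<close>.\<close>

lemma concave_sublinear_sandwich:
  fixes C :: "'a::euclidean_space set" and p :: "'a \<Rightarrow> real"
  assumes C: "C \<noteq> {}" and g: "concave_on C g"
    and p: "convex_on UNIV p" and hom: "\<And>r x. 0 \<le> r \<Longrightarrow> p (r *\<^sub>R x) = r * p x"
    and le: "\<And>x. x \<in> C \<Longrightarrow> g x \<le> p x + V"
  obtains c where "\<And>x. c \<bullet> x \<le> p x" "\<And>x. x \<in> C \<Longrightarrow> g x \<le> c \<bullet> x + V"
proof -
  define S where "S = {z. fst z \<in> C \<and> snd z \<le> g (fst z)}"
  define T where "T = {z. p (fst z) + V < snd z}"
  have "convex S"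
    unfolding S_def using g by (rule convex_hypograph_concave_on)
  moreover have "convex T"
    unfolding convex_def T_def
  proof clarsimp
    fix x y s t and u v :: real
    assume *: "p x + V < s" "p y + V < t" "0 \<le> u" "0 \<le> v" "u + v = 1"
    have "p (u *\<^sub>R x + v *\<^sub>R y) + V \<le> u * p x + v * p y + (u + v) * V"
      using p * by (auto simp: convex_on_def)
    also have "\<dots> = u * (p x + V) + v * (p y + V)"
      by (simp add: algebra_simps)
    also have "\<dots> < u * s + v * t"
    proof (cases "u = 0")
      case False
      then have "u * (p x + V) < u * s" using * by auto
      moreover have "v * (p y + V) \<le> v * t" using * by (intro mult_left_mono) auto
      ultimately show ?thesis by simp
    qed (use * in auto)
    finally show "p (u *\<^sub>R x + v *\<^sub>R y) + V < u * s + v * t" .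
  qed
  moreover have "S \<noteq> {}" using C by (auto simp: S_def intro: exI[of _ "g _"])
  moreover have "(0, p 0 + V + 1) \<in> T" by (simp add: T_def)
  moreover have "S \<inter> T = {}" using le by (force simp: S_def T_def)
  ultimately obtain a \<beta> where a: "a \<noteq> 0" "\<And>z. z \<in> S \<Longrightarrow> a \<bullet> z \<le> \<beta>" "\<And>z. z \<in> T \<Longrightarrow> \<beta> \<le> a \<bullet> z"
    using separating_hyperplane_sets[of S T] by blast
  obtain d \<tau> where d: "a = (d, \<tau>)" by (cases a)
  have sepT: "\<beta> \<le> d \<bullet> x + \<tau> * t" if "p x + V < t" for x t
    using a(3)[of "(x, t)"] that by (simp add: T_def d)
  have sepS: "d \<bullet> x + \<tau> * g x \<le> \<beta>" if "x \<in> C" for x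
    using a(2)[of "(x, g x)"] that by (simp add: S_def d)
  have p0: "p 0 = 0" using hom[of 0 0] by simp
  \<comment> \<open>\<open>T\<close> is unbounded upwards. For negative \<open>\<tau>\<close>, the
    \<open>t\<close> below is high enough that \<open>(0, t)\<close> is in \<open>T\<close>, yet
    \<open>\<tau> * t\<close> drops below \<open>\<beta>\<close>.\<close>
  have "0 \<le> \<tau>"
  proof (rule ccontr)
    assume neg: "\<not> 0 \<le> \<tau>"
    define t where "t = max (V + 1) ((\<beta> - 1) / \<tau>)"
    have "\<tau> * t \<le> \<beta> - 1"
    proof -
      have "(\<beta> - 1) / \<tau> \<le> t" by (simp add: t_def)
      then have "\<tau> * t \<le> \<tau> * ((\<beta> - 1) / \<tau>)" using neg by (intro mult_left_mono_neg) auto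
      then show ?thesis using neg by simp
    qed
    moreover have "\<beta> \<le> \<tau> * t" using sepT[of 0 t] p0 by (auto simp: t_def)
    ultimately show False by simp
  qed
  \<comment> \<open>A vertical hyperplane is impossible: \<open>T\<close> projects onto the whole
    space, and a nonzero linear functional is not bounded below.\<close>
  moreover have "\<tau> \<noteq> 0"
  proof
    assume "\<tau> = 0"
    then have *: "\<beta> \<le> d \<bullet> x" for x using sepT[of x "p x + V + 1"] by simp
    have "d \<noteq> 0" using a(1) d \<open>\<tau> = 0\<close> by (auto simp: zero_prod_def)
    then have "d \<bullet> ((\<beta> - 1) / (d \<bullet> d)) *\<^sub>R d = \<beta> - 1" by simp
    then show False using *[of "((\<beta> - 1) / (d \<bullet> d)) *\<^sub>R d"] by simp
  qed
  ultimately have \<tau>: "0 < \<tau>" by simp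
  \<comment> \<open>Dividing by \<open>\<tau>\<close> turns the hyperplane into the graph of an
    affine function with slope \<open>c\<close> and constant \<open>\<gamma>\<close>, lying between
    \<open>g\<close> and \<open>p + V\<close>.\<close>
  define c where "c = (- 1 / \<tau>) *\<^sub>R d"
  define \<gamma> where "\<gamma> = \<beta> / \<tau>"
  have low: "c \<bullet> x + \<gamma> \<le> p x + V" for x
  proof (rule field_le_epsilon)
    fix e :: real assume "0 < e"
    then show "c \<bullet> x + \<gamma> \<le> p x + V + e"
      using sepT[of x "p x + V + e"] \<tau> by (simp add: c_def \<gamma>_def field_simps)
  qed
  have up: "g x \<le> c \<bullet> x + \<gamma>" if "x \<in> C" for x
    using sepS[OF that] \<tau> by (simp add: c_def \<gamma>_def field_simps)
  have "\<gamma> \<le> V" using low[of 0] p0 by simp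
  show thesis
  proof
    fix x
    show "c \<bullet> x \<le> p x"
    proof (rule ccontr)
      assume "\<not> c \<bullet> x \<le> p x"
      then have pos: "0 < c \<bullet> x - p x" by simp
      \<comment> \<open>By homogeneity, \<open>low\<close> at \<open>r *\<^sub>R x\<close> bounds
        \<open>r * (c \<bullet> x - p x)\<close> by \<open>V - \<gamma>\<close> for every
        nonnegative \<open>r\<close>; this \<open>r\<close> makes the product exceed the bound by
        1.\<close>
      define r where "r = (V - \<gamma> + 1) / (c \<bullet> x - p x)"
      have "0 \<le> r" using pos \<open>\<gamma> \<le> V\<close> by (simp add: r_def)
      then have "r * (c \<bullet> x - p x) \<le> V - \<gamma>"
        using low[of "r *\<^sub>R x"] hom[of r x] by (simp add: algebra_simps)
      then show False using pos by (simp add: r_def)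
    qed
  next
    fix x assume "x \<in> C"
    then show "g x \<le> c \<bullet> x + V" using up[of x] \<open>\<gamma> \<le> V\<close> by simp
  qed
qed

subsection \<open>Linear performance functionals on the polytope\<close>

text \<open>\<open>c k\<close> is the probability of reporting state 1 when \<open>k\<close> agents
  have a high signal. Rules are indexed here by counts, not by fractions.\<close>

definition linear_performance :: "(nat \<Rightarrow> real) \<Rightarrow> real ^ (bool \<times> 'n::finite set) \<Rightarrow> real" where
  "linear_performance c x =
    (\<Sum>D\<in>UNIV. c (card D) * x $ (True, D) + (1 - c (card D)) * x $ (False, D))"

lemma sum_UNIV_by_card:
  fixes F :: "'n::finite set \<Rightarrow> 'b::comm_monoid_add"
  shows "(\<Sum>D\<in>UNIV. F D) = (\<Sum>i=0..CARD('n). \<Sum>D | card D = i. F D)"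
  using sum.group[of "UNIV :: 'n set set" "{0..CARD('n)}" card F]
  by (simp add: image_subset_iff card_mono)

lemma sum_UNIV_bool_prod:
  fixes F :: "bool \<times> 'a::finite \<Rightarrow> 'b::comm_monoid_add"
  shows "(\<Sum>z\<in>UNIV. F z) = (\<Sum>y\<in>UNIV. F (True, y)) + (\<Sum>y\<in>UNIV. F (False, y))"
proof -
  have "(\<Sum>z\<in>UNIV. F z) = (\<Sum>w\<in>UNIV. \<Sum>y\<in>UNIV. F (w, y))"
    by (simp add: sum.cartesian_product)
  then show ?thesis by (simp add: UNIV_bool add.commute)
qed

lemma linear_performance_by_card:
  "linear_performance c (x :: real ^ (bool \<times> 'n::finite set)) =
    (\<Sum>i=0..CARD('n). c i * (\<Sum>D | card D = i. x $ (True, D)) +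
       (1 - c i) * (\<Sum>D | card D = i. x $ (False, D)))"
  unfolding linear_performance_def sum_UNIV_by_card
  by (intro sum.cong refl) (simp add: sum.distrib sum_distrib_left)

lemma linear_performance_le_Pstar:
  fixes x :: "real ^ (bool \<times> 'n::finite set)"
  assumes "\<And>i. i \<le> CARD('n) \<Longrightarrow> c i \<in> {0..1}"
  shows "linear_performance c x \<le> Pstar x"
  unfolding linear_performance_by_card Pstar_def
proof (rule sum_mono)
  fix i assume "i \<in> {0..CARD('n)}"
  then have "0 \<le> c i" "c i \<le> 1" using assms by auto
  then show "c i * (\<Sum>D | card D = i. x $ (True, D)) + (1 - c i) * (\<Sum>D | card D = i. x $ (False, D))
    \<le> max (\<Sum>D | card D = i. x $ (False, D)) (\<Sum>D | card D = i. x $ (True, D))"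
    by (intro convex_bound_le) auto
qed

lemma linear_performance_inner:
  "linear_performance c x =
    (\<chi> z. if fst z then c (card (snd z)) else 1 - c (card (snd z))) \<bullet> x"
  by (simp add: linear_performance_def inner_vec_def sum_UNIV_bool_prod sum.distrib)

lemma continuous_on_linear_performance: "continuous_on S (linear_performance c)"
  unfolding linear_performance_inner by (intro continuous_intros)

lemma continuous_on_Pstar: "continuous_on S Pstar"
  unfolding Pstar_def by (intro continuous_intros)

lemma Pstar_scaleR: "0 \<le> r \<Longrightarrow> Pstar (r *\<^sub>R x) = r * Pstar x"
  unfolding Pstar_def vector_scaleR_component real_scaleR_def sum_distrib_left[symmetric]
  by (simp add: sum_distrib_left max_mult_distrib_left)

lemma Pstar_add: "Pstar (x + y) \<le> Pstar x + Pstar y"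
proof -
  have max: "max (a + b) (c + d) \<le> max a c + max b d" for a b c d :: real
    by linarith
  show ?thesis
    unfolding Pstar_def vector_add_component sum.distrib
    by (rule order_trans[OF sum_mono[OF max]]) (simp add: sum.distrib)
qed

lemma convex_on_Pstar: "convex_on UNIV (Pstar :: real ^ (bool \<times> 'n::finite set) \<Rightarrow> real)"
  unfolding convex_on_def
proof safe
  fix x y :: "real ^ (bool \<times> 'n set)" and u v :: real
  assume "0 \<le> u" "0 \<le> v"
  then show "Pstar (u *\<^sub>R x + v *\<^sub>R y) \<le> u * Pstar x + v * Pstar y"
    using Pstar_add[of "u *\<^sub>R x" "v *\<^sub>R y"] by (simp add: Pstar_scaleR)
qed simp

text \<open>Testing \<open>m\<close> on differences of unit vectors shows that its coefficients depend only on the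
  number of high signals; testing on \<open>axis (True, D) 1 + axis (False, D) 1\<close> and its negative
  shows that the coefficients for the two states sum to 1.\<close>

lemma linear_minorant_Pstar:
  fixes m :: "real ^ (bool \<times> 'n::finite set)"
  assumes m: "\<And>x. m \<bullet> x \<le> Pstar x"
  obtains c where "\<And>i. c i \<in> {0..1}" "\<And>x. m \<bullet> x = linear_performance c x"
proof -
  have axis: "(\<Sum>D | card D = i. (axis (w, E) 1 :: real ^ (bool \<times> 'n set)) $ (w', D)) =
      (if w = w' \<and> card E = i then 1 else 0)" for i w w' E
  proof -
    have "(axis (w, E) 1 :: real ^ (bool \<times> 'n set)) $ (w', D) = (if D = E then of_bool (w = w') else 0)" for D
      by (simp add: axis_def)
    then show ?thesis by simp
  qed
  \<comment> \<open>Both unit vectors sit at the count \<open>card D\<close>, so a single summand of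
    \<open>Pstar\<close> survives.\<close>
  have Pstar_axis: "Pstar (r *\<^sub>R axis (True, D) 1 + s *\<^sub>R axis (False, D) 1) = max s r"
    for r s and D :: "'n set"
  proof -
    have "Pstar (r *\<^sub>R axis (True, D) 1 + s *\<^sub>R axis (False, D) 1) =
        (\<Sum>i=0..CARD('n). if i = card D then max s r else 0)"
      unfolding Pstar_def
      by (intro sum.cong refl) (simp add: sum.distrib axis flip: sum_distrib_left)
    then show ?thesis by (simp add: card_mono)
  qed
  have T: "0 \<le> m $ (True, D)" for D
    using m[of "-1 *\<^sub>R axis (True, D) 1 + 0 *\<^sub>R axis (False, D) 1"] unfolding Pstar_axis
    by (simp add: inner_add_right inner_axis)
  have F: "0 \<le> m $ (False, D)" for D
    using m[of "0 *\<^sub>R axis (True, D) 1 + (-1) *\<^sub>R axis (False, D) 1"] unfolding Pstar_axis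
    by (simp add: inner_add_right inner_axis)
  have TF: "m $ (False, D) = 1 - m $ (True, D)" for D
    using m[of "1 *\<^sub>R axis (True, D) 1 + 1 *\<^sub>R axis (False, D) 1"]
      m[of "(-1) *\<^sub>R axis (True, D) 1 + (-1) *\<^sub>R axis (False, D) 1"] unfolding Pstar_axis
    by (simp add: inner_add_right inner_diff_right inner_axis)
  \<comment> \<open>The two unit vectors cancel in the sum over their common count, so
    \<open>Pstar\<close> of the difference is 0.\<close>
  have eq: "m $ (True, D) \<le> m $ (True, E)" if "card D = card E" for D E
    using m[of "axis (True, D) 1 - axis (True, E) 1"] that
    by (simp add: Pstar_def sum_subtractf axis inner_diff_right inner_axis)
  \<comment> \<open>By \<open>eq\<close> the chosen representative does not matter. The default 0
    keeps \<open>c i\<close> in the unit interval for counts that no set has.\<close>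
  define c where "c i = (if \<exists>D::'n set. card D = i then m $ (True, SOME D. card D = i) else 0)" for i
  have c: "c (card D) = m $ (True, D)" for D
    unfolding c_def using eq[of D] eq[of _ D] someI[of "\<lambda>E. card E = card D" D]
    by (auto intro!: antisym)
  show thesis
  proof
    show "c i \<in> {0..1}" for i
      using T F TF by (auto simp: c_def)
    have "m = (\<chi> z. if fst z then c (card (snd z)) else 1 - c (card (snd z)))"
      by (auto simp: vec_eq_iff c TF)
    then show "m \<bullet> x = linear_performance c x" for x
      by (simp add: linear_performance_inner)
  qed
qed

section \<open>Geometry of the polytope and the minimax rule\<close>

lemma convex_polyC: "convex (polyC \<mu> p1 p2)"
  unfolding convex_def polyC_def
  by (auto simp: sum.distrib simp flip: sum_distrib_left distrib_right)

lemma compact_polyC: "compact (polyC \<mu> p1 p2 :: (real ^ (bool \<times> 'n::finite set)) set)"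
proof -
  let ?B = "cbox 0 (\<chi> z. max \<mu> (1 - \<mu>)) :: (real ^ (bool \<times> 'n::finite set)) set"
  have "closed (polyC \<mu> p1 p2 :: (real ^ (bool \<times> 'n::finite set)) set)"
    unfolding polyC_def
    by (intro closed_Collect_conj closed_Collect_all closed_Collect_le closed_Collect_eq
        continuous_intros)
  moreover have "polyC \<mu> p1 p2 \<subseteq> ?B"
  proof
    fix x :: "real ^ (bool \<times> 'n::finite set)" assume x: "x \<in> polyC \<mu> p1 p2"
    have "x $ (w, D) \<le> max \<mu> (1 - \<mu>)" for w D
    proof -
      have "x $ (w, D) \<le> (\<Sum>D\<in>UNIV. x $ (w, D))"
        using x by (intro member_le_sum) (auto simp: polyC_def)
      then show ?thesis using x by (cases w) (auto simp: polyC_def)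
    qed
    then show "x \<in> ?B" using x by (auto simp: polyC_def mem_box_cart)
  qed
  ultimately show ?thesis
    by (metis compact_cbox compact_Int_closed inf.absorb2)
qed

lemma polyC_nonempty:
  assumes "0 < \<mu>" "\<mu> < 1" "0 \<le> p1" "p2 \<le> 1" "p1 < \<mu>" "\<mu> < p2"
  shows "(polyC \<mu> p1 p2 :: (real ^ (bool \<times> 'n::finite set)) set) \<noteq> {}"
proof -
  define a where "a = a_par \<mu> p1 p2"
  define b where "b = b_par \<mu> p1 p2"
  have "(1 - p2) * (\<mu> - p1) \<le> (1 - \<mu>) * (p2 - p1)"
    using assms by (intro mult_mono) auto
  then have a: "0 \<le> a" "a \<le> 1" using assms by (auto simp: a_def a_par_def)
  \<comment> \<open>This product is the denominator of \<open>b\<close> minus its numerator.\<close>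
  have "p1 * (p2 - \<mu>) \<ge> 0" using assms by simp
  then have "p2 * (\<mu> - p1) \<le> \<mu> * (p2 - p1)" by (simp add: algebra_simps)
  then have b: "0 \<le> b" "b \<le> 1" using assms by (auto simp: b_def b_par_def)
  \<comment> \<open>This needs \<open>UNIV\<close> and \<open>{}\<close> to be different sets of
    agents.\<close>
  have split: "(if D = UNIV then s else if D = {} then t else 0) =
      (if D = UNIV then s else 0) + (if D = {} then t else 0)" for D :: "'n set" and s t :: real
    by auto
  have E: "(\<Sum>D\<in>(UNIV :: 'n set set). if D = UNIV then s else if D = {} then t else 0) = s + t"
    "(\<Sum>D | i \<in> D. if D = UNIV then s else if D = {} then t else 0) = s"
    for s t :: real and i :: 'n
    unfolding split by (simp_all add: sum.distrib)
  \<comment> \<open>The witness is perfect correlation: all agents receive the same signal, high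
    with probability \<open>b\<close> in state 1 and \<open>a\<close> in state 0.\<close>
  define x :: "real ^ (bool \<times> 'n set)" where "x = (\<chi> z. if fst z
      then if snd z = UNIV then \<mu> * b else if snd z = {} then \<mu> * (1 - b) else 0
      else if snd z = UNIV then (1 - \<mu>) * a else if snd z = {} then (1 - \<mu>) * (1 - a) else 0)"
  have x: "x $ (True, D) = (if D = UNIV then \<mu> * b else if D = {} then \<mu> * (1 - b) else 0)"
    "x $ (False, D) = (if D = UNIV then (1 - \<mu>) * a else if D = {} then (1 - \<mu>) * (1 - a) else 0)"
    for D
    by (auto simp: x_def)
  have "0 \<le> x $ (w, D)" for w D
    using a b assms by (cases w) (auto simp: x)
  then have "x \<in> polyC \<mu> p1 p2"
    by (simp add: polyC_def x E flip: a_def b_def) (simp add: algebra_simps)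
  then show ?thesis by blast
qed

text \<open>The sandwich is applied to \<open>cav C Pstar\<close> and the sublinear
  \<open>Pstar\<close>; the resulting linear minorant of \<open>Pstar\<close> is the performance of
  a rule \<open>c\<close>.\<close>

lemma minimax_rule:
  assumes "0 < \<mu>" "\<mu> < 1" "0 \<le> p1" "p2 \<le> 1" "p1 < \<mu>" "\<mu> < p2"
  defines "C \<equiv> polyC \<mu> p1 p2 :: (real ^ (bool \<times> 'n::finite set)) set"
  obtains c where "\<And>i. c i \<in> {0..1}"
    "\<And>x. x \<in> C \<Longrightarrow> Pstar x - linear_performance c x \<le> (SUP x\<in>C. cav C Pstar x - Pstar x)"
proof -
  have C: "compact C" "convex C" "C \<noteq> {}"
    unfolding C_def using assms(1-6) by (simp_all add: compact_polyC convex_polyC polyC_nonempty)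
  define V where "V = (SUP x\<in>C. cav C Pstar x - Pstar x)"
  obtain y where "\<And>x. x \<in> C \<Longrightarrow> cav C Pstar x - Pstar x \<le> cav C Pstar y - Pstar y"
    using cav_gap_attained[OF C continuous_on_Pstar] by blast
  then have V: "cav C Pstar x \<le> Pstar x + V" if "x \<in> C" for x
    using cSUP_upper[OF that, of "\<lambda>x. cav C Pstar x - Pstar x"] unfolding V_def
    by (fastforce intro: bdd_aboveI2)
  have maj: "cav C Pstar \<in> concave_majorants C Pstar"
    using cav_mem_concave_majorants const_concave_majorant[OF C(1,2) continuous_on_Pstar] by blast
  then have "concave_on C (cav C Pstar)" by (simp add: concave_majorants_def)
  from concave_sublinear_sandwich[OF C(3) this convex_on_Pstar Pstar_scaleR V]
  obtain m where m: "\<And>x. m \<bullet> x \<le> Pstar x" "\<And>x. x \<in> C \<Longrightarrow> cav C Pstar x \<le> m \<bullet> x + V"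
    by blast
  from linear_minorant_Pstar[OF m(1)] obtain c
    where c: "\<And>i. c i \<in> {0..1}" "\<And>x. m \<bullet> x = linear_performance c x" by blast
  show thesis
  proof
    fix x assume "x \<in> C"
    then show "Pstar x - linear_performance c x \<le> (SUP x\<in>C. cav C Pstar x - Pstar x)"
      \<comment> \<open>Chains
        \<open>Pstar x \<le> cav C Pstar x \<le> m \<bullet> x + V\<close>.\<close>
      using m(2)[of x] maj c(2)[of x] by (fastforce simp: concave_majorants_def V_def)
  qed (rule c)
qed

subsection \<open>Information structures as points of the polytope\<close>

definition profile :: "'n set \<Rightarrow> 'n \<Rightarrow> signal" where
  "profile D i = (if i \<in> D then H else L)"

lemma profile_eq_iff [simp]: "profile D i = H \<longleftrightarrow> i \<in> D" "profile D i = L \<longleftrightarrow> i \<notin> D"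
  by (simp_all add: profile_def)

lemma frac_high_profile [simp]: "frac_high (profile D :: 'n::finite \<Rightarrow> signal) = real (card D) / real CARD('n)"
  by (simp add: frac_high_def)

lemma profile_high_set [simp]: "profile {i. s i = H} = s"
proof
  fix i
  show "profile {i. s i = H} i = s i" by (cases "s i") (simp_all add: profile_def)
qed

lemma bij_profile: "bij (map_prod id profile)"
  by (rule bij_betw_byWitness[where f' = "map_prod id (\<lambda>s. {i. s i = H})"]) auto

lemma range_profile: "range (map_prod id profile) = UNIV"
  using bij_profile by (rule bij_is_surj)

text \<open>Finiteness of the outcome space is transported from \<open>bool \<times> 'n set\<close>
  along the bijection.\<close>

lemma finite_set_info: "finite (set_pmf (\<pi> :: (bool \<times> ('n::finite \<Rightarrow> signal)) pmf))"
proof -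
  have "finite (range (map_prod id profile :: bool \<times> 'n set \<Rightarrow> bool \<times> ('n \<Rightarrow> signal)))" by simp
  then show ?thesis
    unfolding range_profile by (rule rev_finite_subset) simp
qed

definition coords :: "(bool \<times> ('n::finite \<Rightarrow> signal)) pmf \<Rightarrow> real ^ (bool \<times> 'n set)" where
  "coords \<pi> = (\<chi> z. pmf \<pi> (map_prod id profile z))"

lemma coords_nonneg: "0 \<le> coords \<pi> $ z"
  by (simp add: coords_def)

lemma expectation_coords:
  fixes \<pi> :: "(bool \<times> ('n::finite \<Rightarrow> signal)) pmf" and g :: "_ \<Rightarrow> real"
  shows "measure_pmf.expectation \<pi> g =
    (\<Sum>D\<in>UNIV. g (True, profile D) * coords \<pi> $ (True, D)) +
    (\<Sum>D\<in>UNIV. g (False, profile D) * coords \<pi> $ (False, D))"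
proof -
  have "measure_pmf.expectation \<pi> g = (\<Sum>z\<in>range (map_prod id profile). g z * pmf \<pi> z)"
    by (rule integral_measure_pmf_real) (simp, unfold range_profile, simp)
  also have "\<dots> = (\<Sum>z\<in>UNIV. g (map_prod id profile z) * coords \<pi> $ z)"
    by (subst sum.reindex[OF bij_profile[THEN bij_is_inj]]) (simp add: coords_def)
  finally show ?thesis by (simp add: sum_UNIV_bool_prod)
qed

lemma prob_coords:
  fixes \<pi> :: "(bool \<times> ('n::finite \<Rightarrow> signal)) pmf"
  shows "measure \<pi> {z. Q z} =
    (\<Sum>D | Q (True, profile D). coords \<pi> $ (True, D)) +
    (\<Sum>D | Q (False, profile D). coords \<pi> $ (False, D))"
proof -
  have "measure \<pi> {z. Q z} = measure_pmf.expectation \<pi> (indicator {z. Q z})"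
    by simp
  also have "\<dots> = (\<Sum>D\<in>UNIV. if Q (True, profile D) then coords \<pi> $ (True, D) else 0) +
      (\<Sum>D\<in>UNIV. if Q (False, profile D) then coords \<pi> $ (False, D) else 0)"
    unfolding expectation_coords by (intro arg_cong2[where f="(+)"] sum.cong) auto
  finally show ?thesis
    by (simp add: sum.If_cases)
qed

text \<open>Here \<open>u\<close> and \<open>v\<close> are the probabilities of a high signal
  jointly with state 1 and state 0. Averaging the posteriors back to the prior forces
  \<open>u + v = q\<close>, and Bayes' rule then fixes \<open>u\<close> and \<open>v\<close>.
  Conversely, \<open>0 < q < 1\<close> gives both signals positive probability.\<close>

lemma posterior_system_iff:
  fixes \<mu> p1 p2 u v :: real
  assumes "0 < \<mu>" "\<mu> < 1" "p1 < \<mu>" "\<mu> < p2"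
  shows "0 < (\<mu> - u) + ((1 - \<mu>) - v) \<and> 0 < u + v \<and>
      (\<mu> - u) / ((\<mu> - u) + ((1 - \<mu>) - v)) = p1 \<and> u / (u + v) = p2 \<longleftrightarrow>
    v = (1 - \<mu>) * a_par \<mu> p1 p2 \<and> u = \<mu> * b_par \<mu> p1 p2"
proof -
  define q where "q = (\<mu> - p1) / (p2 - p1)"
  have ab: "(1 - \<mu>) * a_par \<mu> p1 p2 = (1 - p2) * q" "\<mu> * b_par \<mu> p1 p2 = p2 * q"
    using assms by (auto simp: a_par_def b_par_def q_def)
  have q: "0 < q" "q < 1" using assms by (simp_all add: q_def)
  have "q * (p2 - p1) = \<mu> - p1" using assms by (simp add: q_def)
  then have qmu: "p1 * (1 - q) + p2 * q = \<mu>" by (simp add: algebra_simps)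
  show ?thesis
    unfolding ab
  proof (intro iffI conjI; (elim conjE)?)
    assume *: "0 < (\<mu> - u) + ((1 - \<mu>) - v)" "0 < u + v"
      "(\<mu> - u) / ((\<mu> - u) + ((1 - \<mu>) - v)) = p1" "u / (u + v) = p2"
    then have "\<mu> - u = p1 * (1 - (u + v))" "u = p2 * (u + v)"
      by (simp_all add: field_simps)
    then have "(u + v) * (p2 - p1) = \<mu> - p1" by (simp add: algebra_simps)
    then have "u + v = q" using assms by (simp add: q_def field_simps)
    with \<open>u = p2 * (u + v)\<close> show "v = (1 - p2) * q" "u = p2 * q"
      by (simp_all add: algebra_simps)
  next
    assume *: "v = (1 - p2) * q" "u = p2 * q"
    then have e: "u + v = q" "\<mu> - u = p1 * (1 - q)" using qmu by (simp_all add: algebra_simps)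
    then have e': "(\<mu> - u) + ((1 - \<mu>) - v) = 1 - q" by simp
    show "0 < (\<mu> - u) + ((1 - \<mu>) - v)" "0 < u + v"
      unfolding e' e(1) using q by simp_all
    show "u / (u + v) = p2"
      unfolding e(1) using *(2) q by simp
    show "(\<mu> - u) / ((\<mu> - u) + ((1 - \<mu>) - v)) = p1"
      using e(2) e' q by (metis nonzero_mult_div_cancel_right diff_gt_0_iff_gt less_irrefl)
  qed
qed

lemma info_structures_iff_coords:
  fixes \<pi> :: "(bool \<times> ('n::finite \<Rightarrow> signal)) pmf"
  assumes "0 < \<mu>" "\<mu> < 1" "p1 < \<mu>" "\<mu> < p2"
  shows "\<pi> \<in> info_structures \<mu> p1 p2 \<longleftrightarrow> coords \<pi> \<in> polyC \<mu> p1 p2"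
proof -
  define t where "t w = (\<Sum>D\<in>UNIV. coords \<pi> $ (w, D))" for w
  define h where "h w i = (\<Sum>D | i \<in> D. coords \<pi> $ (w, D))" for w i
  \<comment> \<open>Total mass 1 of the pmf supplies the constraint on state 0, which
    \<open>info_structures\<close> leaves implicit.\<close>
  have total: "t False = 1 - t True"
    using prob_coords[of \<pi> "\<lambda>_. True"] by (simp add: t_def)
  have low: "(\<Sum>D | i \<notin> D. coords \<pi> $ (w, D)) = t w - h w i" for w i
  proof -
    have "t w = h w i + (\<Sum>D | i \<notin> D. coords \<pi> $ (w, D))"
      unfolding t_def h_def
      by (subst sum.union_disjoint[symmetric]) (auto intro!: sum.cong)
    then show ?thesis by simp
  qed
  have "\<pi> \<in> info_structures \<mu> p1 p2 \<longleftrightarrow> t True = \<mu> \<and>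
    (\<forall>i. 0 < (t True - h True i) + (t False - h False i) \<and> 0 < h True i + h False i \<and>
      (t True - h True i) / ((t True - h True i) + (t False - h False i)) = p1 \<and>
      h True i / (h True i + h False i) = p2)"
    by (simp add: info_structures_def cond_prob_def prob_coords low t_def h_def)
  also have "\<dots> \<longleftrightarrow> t True = \<mu> \<and> (\<forall>i. h False i = (1 - \<mu>) * a_par \<mu> p1 p2 \<and> h True i = \<mu> * b_par \<mu> p1 p2)"
    unfolding total using posterior_system_iff[OF assms] by metis
  also have "\<dots> \<longleftrightarrow> coords \<pi> \<in> polyC \<mu> p1 p2"
    using total unfolding polyC_def by (auto simp: coords_nonneg t_def h_def)
  finally show ?thesis .
qed

lemma coords_surj:
  fixes x :: "real ^ (bool \<times> 'n::finite set)"
  assumes x: "x \<in> polyC \<mu> p1 p2"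
  obtains \<pi> where "coords \<pi> = x"
proof -
  have nonneg: "0 \<le> x $ z" for z using x by (cases z) (auto simp: polyC_def)
  have "(\<Sum>z\<in>UNIV. x $ z) = 1" using x by (simp add: sum_UNIV_bool_prod polyC_def)
  then have "(\<integral>\<^sup>+z. ennreal (x $ z) \<partial>count_space UNIV) = 1"
    using nonneg by (simp add: nn_integral_count_space_finite)
  then have pmf: "pmf (embed_pmf (($) x)) z = x $ z" for z
    using nonneg by (intro pmf_embed_pmf) auto
  show thesis
    by (rule that[of "map_pmf (map_prod id profile) (embed_pmf (($) x))"])
      (simp add: coords_def vec_eq_iff pmf_map_inj'[OF bij_profile[THEN bij_is_inj]] pmf)
qed

section \<open>Performance, optimal performance and regret in coordinates\<close>

lemma expectation_cond_pmf:
  fixes g :: "'a \<Rightarrow> real"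
  assumes "finite (set_pmf p)" "set_pmf p \<inter> S \<noteq> {}"
  shows "measure_pmf.expectation (cond_pmf p S) g =
    measure_pmf.expectation p (\<lambda>z. indicator S z * g z) / measure p S"
proof -
  have "measure_pmf.expectation (cond_pmf p S) g = (\<Sum>z\<in>set_pmf p. g z * pmf (cond_pmf p S) z)"
    using assms by (intro integral_measure_pmf_real) auto
  also have "\<dots> = (\<Sum>z\<in>set_pmf p. indicator S z * g z * pmf p z) / measure p S"
    unfolding sum_divide_distrib
    by (intro sum.cong refl) (simp add: pmf_cond[OF assms(2)])
  also have "(\<Sum>z\<in>set_pmf p. indicator S z * g z * pmf p z) =
      measure_pmf.expectation p (\<lambda>z. indicator S z * g z)"
    using assms(1) by (intro integral_measure_pmf_real[symmetric]) auto
  finally show ?thesis .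
qed

text \<open>The mass \<open>r\<close> of the state cancels the normalisation of the conditional law,
  which leaves an expression linear in the coordinates.\<close>

lemma expectation_hat_given:
  fixes \<pi> :: "(bool \<times> ('n::finite \<Rightarrow> signal)) pmf"
  assumes "(\<Sum>D\<in>UNIV. coords \<pi> $ (w, D)) = r" "r \<noteq> 0"
  shows "r * measure_pmf.expectation (hat_given w \<pi>) g =
    (\<Sum>D\<in>UNIV. g (real (card D) / real CARD('n)) * coords \<pi> $ (w, D))"
proof -
  have m: "measure (hat \<pi>) {(\<omega>, \<nu>). \<omega> = w} = r"
    using assms(1) unfolding hat_def measure_map_pmf
    by (cases w) (simp_all add: vimage_def case_prod_beta prob_coords)
  then have ne: "set_pmf (hat \<pi>) \<inter> {(\<omega>, \<nu>). \<omega> = w} \<noteq> {}"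
    using assms(2) by (metis measure_pmf_zero_iff)
  have fin: "finite (set_pmf (hat \<pi>))"
    by (simp add: hat_def finite_set_info)
  show ?thesis
    unfolding hat_given_def integral_map_pmf expectation_cond_pmf[OF fin ne] m
    using assms(2) by (cases w) (simp_all add: hat_def case_prod_beta expectation_coords)
qed

lemma performance_coords:
  fixes \<pi> :: "(bool \<times> ('n::finite \<Rightarrow> signal)) pmf"
  assumes "coords \<pi> \<in> polyC \<mu> p1 p2" "0 < \<mu>" "\<mu> < 1"
  shows "performance \<mu> f \<pi> = linear_performance (\<lambda>k. f (real k / real CARD('n))) (coords \<pi>)"
proof -
  have "(\<Sum>D\<in>UNIV. coords \<pi> $ (True, D)) = \<mu>" "(\<Sum>D\<in>UNIV. coords \<pi> $ (False, D)) = 1 - \<mu>"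
    using assms by (auto simp: polyC_def)
  then show ?thesis
    using assms
    by (simp add: performance_def expectation_hat_given linear_performance_def sum.distrib)
qed

lemma opt_performance_coords:
  fixes \<pi> :: "(bool \<times> ('n::finite \<Rightarrow> signal)) pmf"
  shows "opt_performance \<pi> = Pstar (coords \<pi>)"
proof -
  define X where "X w i = (\<Sum>D | card D = i. coords \<pi> $ (w, D))" for w i
  define M where "M \<nu> = max \<P>(z in measure_pmf (hat \<pi>). fst z = False \<bar> snd z = \<nu>)
    \<P>(z in measure_pmf (hat \<pi>). fst z = True \<bar> snd z = \<nu>)" for \<nu>
  have nonneg: "0 \<le> X w i" for w i by (simp add: X_def sum_nonneg coords_nonneg)
  have M: "M (real i / real CARD('n)) =
      max (X False i / (X True i + X False i)) (X True i / (X True i + X False i))" for i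
    unfolding M_def cond_prob_def hat_def measure_map_pmf
    by (simp add: vimage_def case_prod_beta prob_coords X_def)
  \<comment> \<open>Posteriors times the mass of a count give joint masses. For a count of
    probability zero both sides vanish, whatever the quotients evaluate to.\<close>
  have max: "(s + t) * max (t / (s + t)) (s / (s + t)) = max t s" if "0 \<le> s" "0 \<le> t" for s t :: real
  proof (cases "s + t = 0")
    case True
    then show ?thesis using that by auto
  next
    case False
    then show ?thesis using that by (simp add: max_mult_distrib_left)
  qed
  have "opt_performance \<pi> = measure_pmf.expectation \<pi> (\<lambda>z. M (frac_high (snd z)))"
    unfolding opt_performance_def M_def[symmetric] by (simp add: hat_def case_prod_beta)
  also have "\<dots> = (\<Sum>D\<in>UNIV. M (real (card D) / real CARD('n)) *
      (coords \<pi> $ (True, D) + coords \<pi> $ (False, D)))"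
    by (simp add: expectation_coords sum.distrib distrib_left)
  also have "\<dots> = (\<Sum>i=0..CARD('n). (X True i + X False i) * M (real i / real CARD('n)))"
    unfolding sum_UNIV_by_card X_def
    by (intro sum.cong refl) (simp add: sum_distrib_left mult.commute flip: sum.distrib)
  also have "\<dots> = Pstar (coords \<pi>)"
    unfolding M max[OF nonneg nonneg] Pstar_def by (simp add: X_def)
  finally show ?thesis .
qed

text \<open>\<open>coords\<close> maps the information structures onto the polytope, so worst-case
  regret becomes the maximum of a continuous function on a compact set.\<close>

lemma regret_image:
  fixes f :: "real \<Rightarrow> real"
  assumes "0 < \<mu>" "\<mu> < 1" "p1 < \<mu>" "\<mu> < p2"
  defines "C \<equiv> polyC \<mu> p1 p2 :: (real ^ (bool \<times> 'n::finite set)) set"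
  shows "regret \<mu> f ` (info_structures \<mu> p1 p2 :: (bool \<times> ('n \<Rightarrow> signal)) pmf set) =
    (\<lambda>x. Pstar x - linear_performance (\<lambda>k. f (real k / real CARD('n))) x) ` C"
proof -
  let ?I = "info_structures \<mu> p1 p2 :: (bool \<times> ('n \<Rightarrow> signal)) pmf set"
  let ?g = "\<lambda>x :: real ^ (bool \<times> 'n set).
    Pstar x - linear_performance (\<lambda>k. f (real k / real CARD('n))) x"
  note iff = info_structures_iff_coords[OF assms(1-4)]
  have "coords ` ?I = C"
  proof (intro equalityI subsetI)
    fix x assume "x \<in> C"
    moreover from this obtain \<pi> where "coords \<pi> = x"
      unfolding C_def by (rule coords_surj)
    ultimately show "x \<in> coords ` ?I" by (auto simp: C_def iff)
  qed (auto simp: C_def iff)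
  then have "?g ` C = (\<lambda>\<pi>. ?g (coords \<pi>)) ` ?I"
    by (simp add: image_image flip: \<open>coords ` ?I = C\<close>)
  also have "\<dots> = regret \<mu> f ` ?I"
    using assms(1,2)
    by (intro image_cong refl) (simp add: iff regret_def opt_performance_coords performance_coords)
  finally show ?thesis by simp
qed

theorem theorem5p1:
  fixes \<mu> p1 p2 :: real
  assumes "CARD('n::finite) \<ge> 2"
    and "0 < \<mu>" "\<mu> < 1"
    and "0 \<le> p1" "p1 < 1/2" "1/2 < p2" "p2 \<le> 1"
    and "p1 < \<mu>" "\<mu> < p2"
  shows "(\<forall>f \<in> agg_rules CARD('n). \<exists>\<pi> :: (bool \<times> ('n \<Rightarrow> signal)) pmf.
            is_arg_max (regret \<mu> f) (\<lambda>\<pi>. \<pi> \<in> info_structures \<mu> p1 p2) \<pi>) \<and>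
         (\<exists>f. is_arg_min (worst_regret TYPE('n) \<mu> p1 p2) (\<lambda>f. f \<in> agg_rules CARD('n)) f) \<and>
         (\<exists>x :: real ^ (bool \<times> 'n set).
            is_arg_max (\<lambda>x. cav (polyC \<mu> p1 p2) Pstar x - Pstar x) (\<lambda>x. x \<in> polyC \<mu> p1 p2) x) \<and>
         Reg TYPE('n) \<mu> p1 p2 =
           (SUP x \<in> (polyC \<mu> p1 p2 :: (real ^ (bool \<times> 'n set)) set).
              cav (polyC \<mu> p1 p2) Pstar x - Pstar x)"
proof -
  note pars = assms(2,3,4,7,8,9)
  define C where "C = (polyC \<mu> p1 p2 :: (real ^ (bool \<times> 'n set)) set)"
  define I where "I = (info_structures \<mu> p1 p2 :: (bool \<times> ('n \<Rightarrow> signal)) pmf set)"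
  define lp :: "(real \<Rightarrow> real) \<Rightarrow> real ^ (bool \<times> 'n set) \<Rightarrow> real"
    where "lp f = linear_performance (\<lambda>k. f (real k / real CARD('n)))" for f
  define W where "W = worst_regret TYPE('n) \<mu> p1 p2"
  define V where "V = (SUP x\<in>C. cav C Pstar x - Pstar x)"
  have C: "compact C" "convex C" "C \<noteq> {}"
    unfolding C_def using pars by (simp_all add: compact_polyC convex_polyC polyC_nonempty)
  have image: "regret \<mu> f ` I = (\<lambda>x. Pstar x - lp f x) ` C" for f
    unfolding I_def C_def lp_def using regret_image[of \<mu> p1 p2 f] pars by simp
  have W: "W f = (SUP x\<in>C. Pstar x - lp f x)" for f
    unfolding W_def worst_regret_def I_def[symmetric] image ..
  have attained: "\<exists>y\<in>C. \<forall>x\<in>C. Pstar x - lp f x \<le> Pstar y - lp f y" for f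
    unfolding lp_def
    by (intro continuous_attains_sup C continuous_intros continuous_on_Pstar
        continuous_on_linear_performance)
  \<comment> \<open>Attainment also provides the upper bound that makes the real-valued
    \<open>SUP\<close> meaningful.\<close>
  have W_upper: "Pstar x - lp f x \<le> W f" if "x \<in> C" for f x
    unfolding W using attained[of f] by (intro cSUP_upper that) (auto intro: bdd_aboveI2)
  have arg_max: "\<exists>\<pi>. is_arg_max (regret \<mu> f) (\<lambda>\<pi>. \<pi> \<in> I) \<pi>" for f
  proof -
    obtain y where y: "y \<in> C" "\<And>x. x \<in> C \<Longrightarrow> Pstar x - lp f x \<le> Pstar y - lp f y"
      using attained by blast
    then obtain \<pi> where "\<pi> \<in> I" "regret \<mu> f \<pi> = Pstar y - lp f y"
      using image[of f] by (metis (no_types, lifting) imageE image_eqI)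
    moreover have "regret \<mu> f \<rho> \<le> Pstar y - lp f y" if "\<rho> \<in> I" for \<rho>
      using image[of f] y(2) that by (metis (no_types, lifting) imageE image_eqI)
    ultimately show ?thesis by (auto simp: is_arg_max_def not_less)
  qed
  have lower: "V \<le> W f" if f: "f \<in> agg_rules CARD('n)" for f
    unfolding V_def
  proof (rule cSUP_least[OF C(3)])
    fix x assume "x \<in> C"
    have "(\<lambda>y. lp f y + W f) \<in> concave_majorants C Pstar"
      unfolding concave_majorants_def concave_on_iff
    proof (safe intro!: C(2))
      fix y z and u v :: real
      assume "u + v = 1"
      have "u * (lp f y + W f) + v * (lp f z + W f) = lp f (u *\<^sub>R y + v *\<^sub>R z) + (u + v) * W f"
        by (simp add: lp_def linear_performance_inner inner_add_right algebra_simps)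
      then show "u * (lp f y + W f) + v * (lp f z + W f) \<le> lp f (u *\<^sub>R y + v *\<^sub>R z) + W f"
        by (simp add: \<open>u + v = 1\<close>)
    next
      fix y assume "y \<in> C"
      then show "Pstar y \<le> lp f y + W f" using W_upper[of y f] by simp
    qed
    then have "cav C Pstar x \<le> lp f x + W f" using \<open>x \<in> C\<close> by (rule cav_le)
    \<comment> \<open>Bounding \<open>Pstar x\<close> from below by \<open>lp f x\<close> cancels
      the linear part and leaves \<open>W f\<close>.\<close>
    moreover have "lp f x \<le> Pstar x"
      unfolding lp_def using f
      by (intro linear_performance_le_Pstar) (auto simp: agg_rules_def PiE_def Pi_def)
    ultimately show "cav C Pstar x - Pstar x \<le> W f" by simp
  qed
  obtain c where c: "\<And>i. c i \<in> {0..1}" "\<And>x. x \<in> C \<Longrightarrow> Pstar x - linear_performance c x \<le> V"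
    using minimax_rule[OF pars] unfolding C_def V_def by blast
  \<comment> \<open>The floor recovers the count \<open>k\<close> from the fraction
    \<open>k / n\<close>; \<open>restrict\<close> makes \<open>f\<close> extensional, as
    \<open>agg_rules\<close> demands.\<close>
  define f where "f = restrict (\<lambda>\<nu>. c (nat \<lfloor>\<nu> * real CARD('n)\<rfloor>)) {real k / real CARD('n) |k. k \<le> CARD('n)}"
  have f: "f \<in> agg_rules CARD('n)"
    using c(1) by (auto simp: f_def agg_rules_def)
  have "f (real k / real CARD('n)) = c k" if "k \<le> CARD('n)" for k
    using that by (auto simp: f_def)
  then have "lp f = linear_performance c"
    by (auto simp: lp_def linear_performance_def card_mono fun_eq_iff)
  then have "W f \<le> V"
    unfolding W by (intro cSUP_least[OF C(3)]) (simp add: c(2))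
  then have Wf: "W f = V" using lower[OF f] by simp
  then have arg_min: "is_arg_min W (\<lambda>f. f \<in> agg_rules CARD('n)) f"
    using f lower by (auto simp: is_arg_min_def not_less)
  have "Reg TYPE('n) \<mu> p1 p2 = V"
    unfolding Reg_def W_def[symmetric]
  proof (rule antisym)
    show "(INF f\<in>agg_rules CARD('n). W f) \<le> V"
      using cINF_lower[OF _ f, of W] lower Wf by (metis bdd_belowI2)
    show "V \<le> (INF f\<in>agg_rules CARD('n). W f)"
      using f lower by (intro cINF_greatest) auto
  qed
  moreover have "\<exists>x. is_arg_max (\<lambda>x. cav C Pstar x - Pstar x) (\<lambda>x. x \<in> C) x"
    using cav_gap_attained[OF C continuous_on_Pstar] by (auto simp: is_arg_max_def not_less)
  ultimately show ?thesis
    using arg_max arg_min unfolding C_def I_def V_def W_def by blast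
qed

end
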